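(* Let $G\subseteq GL_n(\mathbb{C})$ be a finite matrix group. Then $$\bigcup_{k \in \mathcal{K}} \Pi_k \subseteq \mathrm{HS}(G) \subseteq \mathrm{Co} \left( \bigcup_{k \in \mathcal{K}} \Pi_k \right),$$ in which $\mathcal{K}$ is the set of positive integers $k$ such that some $A \in G$ has a primitive $k$th root of unity as an eigenvalue.
   Context: $\mathrm{Co}(X)$ denotes the convex hull of $X$, i.e. the set of all (finite) convex combinations of elements of $X$, for $X$ a set of matrices or of complex numbers. For a set $S \subseteq M_n(\mathbb{C})$, the hull spectrum $\mathrm{HS}(S)\subseteq\mathbb{C}$ is the set of all complex numbers that occur as eigenvalues of some matrix in $\mathrm{Co}(S)$. $\Pi_k$ denotes the convex hull in $\mathbb{C}$ of the $k$th roots of unity. *)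

theory Defs
  imports "HOL-Analysis.Analysis" "HOL-Algebra.Group"
begin

definition GL :: "(complex ^ 'n ^ 'n) monoid" where
  "GL = \<lparr>carrier = {A. invertible A}, monoid.mult = (**), one = mat 1\<rparr>"

lemma group_GL: "group (GL :: (complex ^ 'n ^ 'n) monoid)"
proof (rule groupI)
  have "invertible (mat 1 :: complex ^ 'n ^ 'n)"
    unfolding invertible_def by (rule exI[of _ "mat 1"]) simp
  then show "\<one>\<^bsub>GL\<^esub> \<in> carrier (GL :: (complex ^ 'n ^ 'n) monoid)"
    by (simp add: GL_def)
next
  fix A :: "complex ^ 'n ^ 'n"
  assume "A \<in> carrier GL"
  then obtain B where "A ** B = mat 1" "B ** A = mat 1"
    by (auto simp: GL_def invertible_def)
  then show "\<exists>B\<in>carrier GL. B \<otimes>\<^bsub>GL\<^esub> A = \<one>\<^bsub>GL\<^esub>"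
    by (auto simp: GL_def invertible_def)
qed (use invertible_mult in \<open>auto simp: GL_def matrix_mul_assoc\<close>)

definition eigenvalue :: "complex ^ 'n ^ 'n \<Rightarrow> complex \<Rightarrow> bool" where
  "eigenvalue A z \<longleftrightarrow> (\<exists>v. v \<noteq> 0 \<and> A *v v = z *s v)"

text \<open>The convex hull of a set of complex matrices is taken with respect to the entrywise
  real vector space structure, so the coefficients of convex combinations are real.\<close>

definition hull_spectrum :: "(complex ^ 'n ^ 'n) set \<Rightarrow> complex set" where
  "hull_spectrum S = {z. \<exists>A \<in> convex hull S. eigenvalue A z}"

definition primitive_root_of_unity :: "nat \<Rightarrow> complex \<Rightarrow> bool" where
  "primitive_root_of_unity k z \<longleftrightarrow> k > 0 \<and> z ^ k = 1 \<and> (\<forall>j. 0 < j \<and> j < k \<longrightarrow> z ^ j \<noteq> 1)"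

definition roots_hull :: "nat \<Rightarrow> complex set" where
  "roots_hull k = convex hull {z. z ^ k = 1}"

definition eigenvalue_orders :: "(complex ^ 'n ^ 'n) set \<Rightarrow> nat set" where
  "eigenvalue_orders G =
     {k. k > 0 \<and> (\<exists>A \<in> G. \<exists>z. primitive_root_of_unity k z \<and> eigenvalue A z)}"

end

(* Averaging the standard Hermitian form over G makes every element of G unitary. If A v = z v with
   A in Co(G), then z = <A v, v> / <v, v> is a convex combination of the numbers <g v, v> / <v, v>
   with g in G, and decomposing v into orthogonal eigenvectors of g shows that each of these is a
   convex combination of eigenvalues of g, which are roots of unity. Conversely, if g v = z v, then
   the powers of g have the eigenvalues z^j at the same vector v, so every convex combination of
   these powers has v as an eigenvector. *)
theory Submission
  imports Defs "HOL-Algebra.Multiplicative_Group"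
begin

section \<open>Eigenvalues attained at a fixed vector\<close>

lemma scaleR_mult_vec: "(r *\<^sub>R A) *v x = of_real r *s (A *v (x :: complex ^ 'n))"
  by (simp add: vec_eq_iff matrix_vector_mult_def sum_distrib_left mult.assoc scaleR_conv_of_real[where 'a = complex])

text \<open>The vector stays fixed while the matrix varies over \<open>S\<close>: a convex
  combination of matrices sharing the eigenvector \<open>v\<close> has \<open>v\<close> as
  eigenvector for the same combination of eigenvalues.\<close>

lemma convex_eigenvalues_at_vector:
  fixes v :: "complex ^ 'n"
  assumes "convex S"
  shows "convex {z. \<exists>A\<in>S. A *v v = z *s v}"
proof (rule convexI, clarify)
  fix z w A B and a b :: real
  assume ab: "0 \<le> a" "0 \<le> b" "a + b = 1" and "A \<in> S" "B \<in> S"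
    and eq: "A *v v = z *s v" "B *v v = w *s v"
  then have "a *\<^sub>R A + b *\<^sub>R B \<in> S"
    using assms by (simp add: convex_def)
  moreover have "(a *\<^sub>R A + b *\<^sub>R B) *v v = (a *\<^sub>R z + b *\<^sub>R w) *s v"
    by (simp add: matrix_vector_mult_add_rdistrib scaleR_mult_vec eq scaleR_conv_of_real[where 'a = complex]
        vector_sadd_rdistrib vector_smult_assoc)
  ultimately show "\<exists>A\<in>S. A *v v = (a *\<^sub>R z + b *\<^sub>R w) *s v" by blast
qed

section \<open>Roots of unity and the spectral decomposition of a matrix of finite order\<close>

lemma primitive_root_of_unity_exists:
  assumes "m > 0" "z ^ m = 1"
  obtains k where "primitive_root_of_unity k z"
proof
  let ?P = "\<lambda>k. 0 < k \<and> z ^ k = 1"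
  have "?P (LEAST k. ?P k)" by (rule LeastI[of ?P m]) (use assms in simp)
  then show "primitive_root_of_unity (LEAST k. ?P k) z"
    unfolding primitive_root_of_unity_def using not_less_Least[of _ ?P] by blast
qed

text \<open>A counting argument: primitivity makes the powers with exponents below \<open>k\<close>
  distinct, and there are exactly \<open>k\<close> roots of unity to be hit.\<close>

lemma roots_unity_eq_powers:
  assumes "primitive_root_of_unity k z"
  shows "{w. w ^ k = 1} = (\<lambda>j. z ^ j) ` {..<k}"
proof -
  have k: "k > 0" "z ^ k = 1" and min: "\<And>j. 0 < j \<Longrightarrow> j < k \<Longrightarrow> z ^ j \<noteq> 1"
    using assms by (auto simp: primitive_root_of_unity_def)
  then have z0: "z \<noteq> 0" by (auto simp: power_0_left)
  have "i = j" if "i \<le> j" "j < k" "z ^ i = z ^ j" for i j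
  proof -
    have "z ^ i * z ^ (j - i) = z ^ i * 1"
      unfolding power_add[symmetric] using that by simp
    then have "z ^ (j - i) = 1" using z0 by simp
    then show ?thesis using min[of "j - i"] that by (cases "i = j") auto
  qed
  then have "inj_on (\<lambda>j. z ^ j) {..<k}"
    by (intro inj_onI) (metis lessThan_iff nle_le)
  then have "card ((\<lambda>j. z ^ j) ` {..<k}) = k" by (simp add: card_image)
  moreover have "(\<lambda>j. z ^ j) ` {..<k} \<subseteq> {w. w ^ k = 1}"
    using k by (auto simp flip: power_mult simp: mult.commute[of _ k]) (simp add: power_mult)
  ultimately show ?thesis
    using k by (intro card_subset_eq[symmetric]) (auto simp: card_roots_unity_eq finite_roots_unity)
qed

text \<open>Multiplication by \<zeta> = exp(2 pi i / m) permutes the roots, so the sum equals itself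
  times the inverse of \<zeta>^j, a factor different from 1.\<close>

lemma sum_roots_unity_inverse_power:
  assumes "0 < j" "j < m"
  shows "(\<Sum>w | w ^ m = (1::complex). inverse w ^ j) = 0"
proof -
  define \<zeta> where "\<zeta> = cis (2 * pi / real m)"
  have m: "m > 0" using assms by simp
  note bij = Complex.bij_betw_roots_unity[OF m]
  have pow: "\<zeta> ^ i = cis (2 * pi * real i / real m)" for i
    unfolding \<zeta>_def Complex.DeMoivre by (simp add: mult_ac)
  have \<zeta>j: "\<zeta> ^ j \<noteq> 1"
    using inj_onD[OF bij_betw_imp_inj_on[OF bij], of j 0] assms by (auto simp: pow)
  have \<zeta>m: "\<zeta> ^ m = 1" using m by (simp add: pow)
  have \<zeta>0: "\<zeta> \<noteq> 0" by (simp add: \<zeta>_def)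
  have "bij_betw ((*) \<zeta>) {w. w ^ m = 1} {w. w ^ m = 1}"
    by (rule bij_betw_byWitness[where f' = "\<lambda>w. w / \<zeta>"])
      (auto simp: \<zeta>0 \<zeta>m power_mult_distrib power_divide)
  from sum.reindex_bij_betw[OF this, of "\<lambda>w. inverse w ^ j"]
  have "(\<Sum>w | w ^ m = 1. inverse w ^ j) = inverse \<zeta> ^ j * (\<Sum>w | w ^ m = 1. inverse w ^ j)"
    by (simp add: power_mult_distrib sum_distrib_left)
  moreover have "inverse \<zeta> ^ j \<noteq> 1" using \<zeta>j by (simp add: power_inverse)
  ultimately show ?thesis by simp
qed

text \<open>\<open>P j\<close> plays the role of the \<open>j\<close>th power of \<open>g\<close>.
  The vector \<open>u w\<close> is the spectral projection of \<open>v\<close> for \<open>w\<close>,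
  a discrete Fourier transform of the orbit of \<open>v\<close>; it may be zero.\<close>

lemma finite_order_eigen_decomposition:
  fixes P :: "nat \<Rightarrow> complex ^ 'n ^ 'n"
  assumes m: "m > 0" and P: "P 0 = mat 1" "\<And>j. P (Suc j) = g ** P j" "P m = mat 1"
  obtains u where "\<And>w. w ^ m = 1 \<Longrightarrow> g *v u w = w *s u w"
    and "(\<Sum>w | w ^ m = 1. u w) = v"
proof
  define u where "u w = (\<Sum>j<m. (inverse w ^ j / of_nat m) *s (P j *v v))" for w :: complex
  show "g *v u w = w *s u w" if w: "w ^ m = 1" for w
  proof -
    \<comment> \<open>\<open>f j\<close> is \<open>w\<close> times the \<open>j\<close>th summand of
      \<open>u w\<close>. Its factor \<open>w\<close> cancels one \<open>inverse w\<close> in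
      \<open>f (Suc j)\<close>, so that \<open>f (Suc j)\<close> is the image under \<open>g\<close>
      of the \<open>j\<close>th summand.\<close>
    define f where "f j = (w * inverse w ^ j / of_nat m) *s (P j *v v)" for j
    have w0: "w \<noteq> 0" using w m by (auto simp: power_0_left)
    have "g *v u w = (\<Sum>j<m. g *v ((inverse w ^ j / of_nat m) *s (P j *v v)))"
      unfolding u_def by (rule linear_sum[OF matrix_vector_mul_linear])
    also have "\<dots> = (\<Sum>j<m. f (Suc j))"
      by (simp add: f_def P(2) vector_scalar_commute matrix_vector_mul_assoc w0 flip: mult.assoc)
    also have "\<dots> = (\<Sum>j<m. f j)"
    proof -
      have "f 0 = f m" using w by (simp add: f_def P power_inverse)
      moreover have "(\<Sum>j<m. f j) + f m = f 0 + (\<Sum>j<m. f (Suc j))"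
        using sum.lessThan_Suc_shift[of f m] by simp
      ultimately show ?thesis by simp
    qed
    also have "\<dots> = w *s u w"
      by (simp add: f_def u_def vec_eq_iff sum_distrib_left mult_ac)
    finally show ?thesis .
  qed
  \<comment> \<open>Fourier inversion: the inner sum over the roots is \<open>m\<close> for
    \<open>j = 0\<close> and vanishes otherwise.\<close>
  have "(\<Sum>w | w ^ m = 1. u w) =
      (\<Sum>j<m. ((\<Sum>w | w ^ m = 1. inverse w ^ j) / of_nat m) *s (P j *v v))"
    unfolding u_def
    by (subst sum.swap) (simp add: vec_eq_iff sum_divide_distrib sum_distrib_right)
  also have "\<dots> = (\<Sum>j<m. if j = 0 then v else 0)"
    using m by (intro sum.cong) (auto simp: sum_roots_unity_inverse_power P card_roots_unity_eq)
  also have "\<dots> = v" using m by simp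
  finally show "(\<Sum>w | w ^ m = 1. u w) = v" .
qed

section \<open>The G-invariant Hermitian form\<close>

definition averaged_form ::
  "(complex ^ 'n ^ 'n) set \<Rightarrow> complex ^ 'n \<Rightarrow> complex ^ 'n \<Rightarrow> complex" where
  "averaged_form G x y = (\<Sum>h\<in>G. \<Sum>i\<in>UNIV. (h *v x) $ i * cnj ((h *v y) $ i))"

lemma averaged_form_add_left:
  "averaged_form G (x + y) z = averaged_form G x z + averaged_form G y z"
  by (simp add: averaged_form_def matrix_vector_right_distrib distrib_right sum.distrib)

lemma averaged_form_add_right:
  "averaged_form G x (y + z) = averaged_form G x y + averaged_form G x z"
  by (simp add: averaged_form_def matrix_vector_right_distrib distrib_left sum.distrib)

lemma averaged_form_zero [simp]: "averaged_form G 0 y = 0" "averaged_form G x 0 = 0"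
  by (simp_all add: averaged_form_def)

lemma averaged_form_sum_left: "averaged_form G (\<Sum>a\<in>S. f a) y = (\<Sum>a\<in>S. averaged_form G (f a) y)"
  by (induction S rule: infinite_finite_induct) (simp_all add: averaged_form_add_left)

lemma averaged_form_sum_right: "averaged_form G x (\<Sum>a\<in>S. f a) = (\<Sum>a\<in>S. averaged_form G x (f a))"
  by (induction S rule: infinite_finite_induct) (simp_all add: averaged_form_add_right)

lemma averaged_form_scale_left: "averaged_form G (c *s x) y = c * averaged_form G x y"
  by (simp add: averaged_form_def vector_scalar_commute sum_distrib_left mult_ac)

lemma averaged_form_scale_right: "averaged_form G x (c *s y) = cnj c * averaged_form G x y"
  by (simp add: averaged_form_def vector_scalar_commute sum_distrib_left mult_ac)

lemma averaged_form_self: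
  "averaged_form G x x = of_real (\<Sum>h\<in>G. \<Sum>i\<in>UNIV. (cmod ((h *v x) $ i))\<^sup>2)"
  by (simp add: averaged_form_def complex_norm_square del: of_real_power)

lemma averaged_form_self_nonneg: "0 \<le> Re (averaged_form G x x)"
  by (simp add: averaged_form_self sum_nonneg)

lemma averaged_form_self_real: "averaged_form G x x = of_real (Re (averaged_form G x x))"
  by (simp only: averaged_form_self Re_complex_of_real)

text \<open>The summand for the identity matrix is the standard squared norm, already positive, and
  the other summands are nonnegative.\<close>

lemma averaged_form_self_pos:
  assumes "finite G" "mat 1 \<in> G" "x \<noteq> 0"
  shows "0 < Re (averaged_form G x x)"
proof -
  obtain i where i: "x $ i \<noteq> 0" using assms(3) by (auto simp: vec_eq_iff)
  have "0 < (\<Sum>i\<in>UNIV. (cmod ((mat 1 *v x) $ i))\<^sup>2)"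
    by (rule sum_pos2[of _ i]) (use i in auto)
  also have "\<dots> \<le> (\<Sum>h\<in>G. \<Sum>i\<in>UNIV. (cmod ((h *v x) $ i))\<^sup>2)"
    by (rule member_le_sum) (use assms in \<open>auto intro: sum_nonneg\<close>)
  finally show ?thesis by (simp add: averaged_form_self)
qed

text \<open>Right multiplication by \<open>g\<close> permutes \<open>G\<close>, so it only reindexes
  the sum defining the form.\<close>

lemma averaged_form_invariant:
  assumes "subgroup G GL" "g \<in> G"
  shows "averaged_form G (g *v x) (g *v y) = averaged_form G x y"
proof -
  interpret H: group "GL\<lparr>carrier := G\<rparr>"
    by (rule subgroup.subgroup_is_group[OF assms(1) group_GL])
  have "bij_betw (\<lambda>h. h ** g) G G"
    using assms(2) H.inv_closed[of g] H.l_inv[of g] H.r_inv[of g] H.m_closed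
    by (intro bij_betw_byWitness[where f' = "\<lambda>h. h ** inv\<^bsub>GL\<lparr>carrier := G\<rparr>\<^esub> g"])
      (auto simp: GL_def simp flip: matrix_mul_assoc)
  from sum.reindex_bij_betw[OF this, of "\<lambda>h. \<Sum>i\<in>UNIV. (h *v x) $ i * cnj ((h *v y) $ i)"]
  show ?thesis by (simp add: averaged_form_def matrix_vector_mul_assoc)
qed

text \<open>Invariance multiplies the form value by \<open>z * cnj w\<close> without changing it. On
  the unit circle \<open>cnj w\<close> is the inverse of \<open>w\<close>, so this factor is 1 only
  if \<open>z = w\<close>.\<close>

lemma averaged_form_orthogonal_eigenvectors:
  assumes "subgroup G GL" "g \<in> G" "g *v x = z *s x" "g *v y = w *s y"
    and "cmod w = 1" "z \<noteq> w"
  shows "averaged_form G x y = 0"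
proof -
  have "z * cnj w * averaged_form G x y = averaged_form G x y"
    using averaged_form_invariant[OF assms(1,2), of x y] assms(3,4)
    by (simp add: averaged_form_scale_left averaged_form_scale_right mult_ac)
  moreover have "z * cnj w \<noteq> 1"
  proof
    assume "z * cnj w = 1"
    then have "z * (w * cnj w) = w" by (simp add: mult_ac)
    then show False using assms(5,6) by (simp flip: complex_norm_square)
  qed
  ultimately show ?thesis by simp
qed

section \<open>The two inclusions for a finite matrix group\<close>

context
  fixes G :: "(complex ^ 'n ^ 'n) set"
  assumes G: "subgroup G GL" and fin: "finite G"
begin

interpretation H: group "GL\<lparr>carrier := G\<rparr>"
  by (rule subgroup.subgroup_is_group[OF G group_GL])

lemma power_eigenvalue_at_vector:
  assumes g: "g \<in> G" and eig: "g *v v = z *s v"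
  shows "\<exists>A\<in>G. A *v v = z ^ j *s v"
proof (induction j)
  case 0
  have "mat 1 \<in> G" using H.one_closed by (simp add: GL_def)
  then show ?case by (intro bexI[of _ "mat 1"]) auto
next
  case (Suc j)
  then obtain A where A: "A \<in> G" "A *v v = z ^ j *s v" by blast
  have "g ** A \<in> G" using H.m_closed[of g A] g A(1) by (simp add: GL_def)
  moreover have "(g ** A) *v v = z ^ Suc j *s v"
    by (simp add: A eig vector_scalar_commute vector_smult_assoc mult_ac flip: matrix_vector_mul_assoc)
  ultimately show ?case by blast
qed

text \<open>All \<open>k\<close>th roots of unity are powers of \<open>z\<close>, hence attained at
  the single vector \<open>v\<close>; convexity at \<open>v\<close> then covers their hull.\<close>

lemma roots_hull_subset_hull_spectrum:
  assumes "k \<in> eigenvalue_orders G"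
  shows "roots_hull k \<subseteq> hull_spectrum G"
proof -
  obtain g z v where g: "g \<in> G" "primitive_root_of_unity k z" "v \<noteq> 0" "g *v v = z *s v"
    using assms by (auto simp: eigenvalue_orders_def eigenvalue_def)
  have "\<exists>A\<in>convex hull G. A *v v = z ^ j *s v" for j
    using power_eigenvalue_at_vector[OF g(1,4), of j] hull_inc by metis
  then have "roots_hull k \<subseteq> {z. \<exists>A\<in>convex hull G. A *v v = z *s v}"
    unfolding roots_hull_def roots_unity_eq_powers[OF g(2)]
    by (intro hull_minimal convex_eigenvalues_at_vector) auto
  also have "\<dots> \<subseteq> hull_spectrum G"
    using g(3) by (auto simp: hull_spectrum_def eigenvalue_def)
  finally show ?thesis .
qed

text \<open>The exponent \<open>m\<close> only certifies that \<open>w\<close> is a root of unity;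
  the relevant \<open>k\<close> is the exact order of \<open>w\<close>.\<close>

lemma eigenvalue_in_roots_hull:
  assumes "g \<in> G" "x \<noteq> 0" "g *v x = w *s x" "m > 0" "w ^ m = 1"
  shows "w \<in> (\<Union>k \<in> eigenvalue_orders G. roots_hull k)"
proof -
  obtain k where k: "primitive_root_of_unity k w"
    using primitive_root_of_unity_exists assms(4,5) by blast
  then have "k \<in> eigenvalue_orders G"
    using assms(1-3) by (auto simp: eigenvalue_orders_def eigenvalue_def primitive_root_of_unity_def)
  moreover have "w \<in> roots_hull k"
    using k by (auto simp: roots_hull_def primitive_root_of_unity_def intro: hull_inc)
  ultimately show ?thesis by blast
qed

text \<open>With \<open>v\<close> split into orthogonal eigenvectors \<open>u w\<close> of
  \<open>g\<close>, the quotient is the mean of the eigenvalues \<open>w\<close> with weights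
  \<open>a w\<close>, the shares of the \<open>u w\<close> in the squared length of
  \<open>v\<close>. Normalizing the form by \<open>card G\<close> would not change it.\<close>

lemma numerical_range_element:
  assumes g: "g \<in> G" and v: "v \<noteq> 0"
  shows "averaged_form G (g *v v) v / averaged_form G v v
    \<in> convex hull (\<Union>k \<in> eigenvalue_orders G. roots_hull k)" (is "_ \<in> convex hull ?R")
proof -
  let ?H = "averaged_form G"
  \<comment> \<open>By Lagrange, the group order is an exponent that works for every element
    \<open>g\<close>.\<close>
  define m where "m = card G"
  define N where "N = Re (?H v v)"
  have one: "mat 1 \<in> G" using H.one_closed by (simp add: GL_def)
  then have m: "m > 0" using fin by (auto simp: m_def card_gt_0_iff)
  define P where "P j = g [^]\<^bsub>GL\<lparr>carrier := G\<rparr>\<^esub> j" for j :: nat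
  have "P 0 = mat 1" by (simp add: P_def GL_def)
  moreover have "P (Suc j) = g ** P j" for j
    unfolding P_def using g by (subst H.nat_pow_Suc2) (simp_all add: GL_def)
  moreover have "P m = mat 1"
    using H.pow_order_eq_1[of g] g by (simp add: P_def m_def order_def) (simp add: GL_def)
  ultimately obtain u where u: "\<And>w. w ^ m = 1 \<Longrightarrow> g *v u w = w *s u w"
    and sum_u: "(\<Sum>w | w ^ m = 1. u w) = v"
    using finite_order_eigen_decomposition[OF m, of P g v] by metis
  have fin_roots: "finite {w::complex. w ^ m = 1}" using m by (simp add: finite_roots_unity)
  have norm1: "cmod w = 1" if "w ^ m = 1" for w
    using that m by (metis norm_one norm_power power_eq_1_iff norm_ge_zero neq0_conv)
  \<comment> \<open>Expanding \<open>v\<close> in its components leaves only the diagonal term, by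
    orthogonality.\<close>
  have proj: "?H (u w) v = ?H (u w) (u w)" if w: "w ^ m = 1" for w
  proof -
    have "?H (u w) v = (\<Sum>w' | w' ^ m = 1. ?H (u w) (u w'))"
      by (simp add: averaged_form_sum_right flip: sum_u)
    also have "\<dots> = (\<Sum>w' | w' ^ m = 1. if w' = w then ?H (u w) (u w) else 0)"
      using averaged_form_orthogonal_eigenvectors[OF G g u u norm1] w
      by (intro sum.cong) auto
    also have "\<dots> = ?H (u w) (u w)" using w fin_roots by simp
    finally show ?thesis .
  qed
  have N: "N > 0" using averaged_form_self_pos[OF fin one v] by (simp add: N_def)
  have HN: "?H v v = of_real N" unfolding N_def by (rule averaged_form_self_real)
  \<comment> \<open>Roots with \<open>u w = 0\<close> are dropped, since they need not be
    eigenvalues of \<open>g\<close> and so need not lie in \<open>?R\<close>.\<close>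
  define W where "W = {w. w ^ m = 1 \<and> u w \<noteq> 0}"
  define a where "a w = Re (?H (u w) (u w)) / N" for w
  have finW: "finite W" unfolding W_def by (rule finite_subset[OF _ fin_roots]) auto
  have a: "?H (u w) (u w) / ?H v v = of_real (a w)" for w
    using averaged_form_self_real[of G "u w"] by (simp add: a_def HN)
  have "(\<Sum>w\<in>W. a w) = 1"
  proof -
    \<comment> \<open>Pythagoras: the squared length of \<open>v\<close> is the sum of those of its
      components.\<close>
    have "?H v v = (\<Sum>w | w ^ m = 1. ?H (u w) v)"
      by (simp flip: averaged_form_sum_left add: sum_u)
    also have "\<dots> = (\<Sum>w\<in>W. ?H (u w) (u w))"
      unfolding W_def by (intro sum.mono_neutral_cong_right fin_roots) (auto simp: proj)
    finally have "?H v v / ?H v v = (\<Sum>w\<in>W. ?H (u w) (u w) / ?H v v)"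
      by (simp only: sum_divide_distrib)
    then have "of_real (\<Sum>w\<in>W. a w) = (1::complex)"
      using N by (simp add: a) (simp add: HN)
    then show ?thesis by (simp only: of_real_eq_1_iff)
  qed
  moreover have "?H (g *v v) v / ?H v v = (\<Sum>w\<in>W. a w *\<^sub>R w)"
  proof -
    have "g *v v = (\<Sum>w | w ^ m = 1. g *v u w)"
      unfolding sum_u[symmetric] by (rule linear_sum[OF matrix_vector_mul_linear])
    also have "\<dots> = (\<Sum>w | w ^ m = 1. w *s u w)" using u by simp
    finally have "?H (g *v v) v = (\<Sum>w | w ^ m = 1. w * ?H (u w) v)"
      by (simp add: averaged_form_sum_left averaged_form_scale_left)
    also have "\<dots> = (\<Sum>w\<in>W. w * ?H (u w) (u w))"
      unfolding W_def by (intro sum.mono_neutral_cong_right fin_roots) (auto simp: proj)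
    finally have "?H (g *v v) v / ?H v v = (\<Sum>w\<in>W. w * (?H (u w) (u w) / ?H v v))"
      by (simp add: sum_divide_distrib)
    then show ?thesis by (simp add: a scaleR_conv_of_real[where 'a = complex] mult.commute)
  qed
  moreover have "w \<in> convex hull ?R" if "w \<in> W" for w
    using that eigenvalue_in_roots_hull[OF g _ u m] by (auto simp: W_def intro!: hull_inc)
  moreover have "a w \<ge> 0" for w
    using N by (simp add: a_def averaged_form_self_nonneg)
  ultimately show ?thesis
    using convex_sum[OF finW convex_convex_hull, of a "\<lambda>w. w"] by simp
qed

lemma hull_spectrum_subset:
  "hull_spectrum G \<subseteq> convex hull (\<Union>k \<in> eigenvalue_orders G. roots_hull k)" (is "_ \<subseteq> convex hull ?R")
proof
  fix z assume "z \<in> hull_spectrum G"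
  then obtain A v where A: "A \<in> convex hull G" "v \<noteq> 0" "A *v v = z *s v"
    by (auto simp: hull_spectrum_def eigenvalue_def)
  \<comment> \<open>The Rayleigh quotient at the fixed vector \<open>v\<close> is linear in the
    matrix, so a bound on \<open>G\<close> passes to the convex hull of \<open>G\<close>; at
    \<open>A\<close> its value is \<open>z\<close>.\<close>
  define f where "f B = averaged_form G (B *v v) v / averaged_form G v v" for B
  have "linear f"
    by (rule linearI) (simp_all add: f_def matrix_vector_mult_add_rdistrib averaged_form_add_left
        add_divide_distrib scaleR_mult_vec averaged_form_scale_left scaleR_conv_of_real[where 'a = complex])
  then have "f ` (convex hull G) = convex hull (f ` G)"
    by (rule convex_hull_linear_image)
  also have "\<dots> \<subseteq> convex hull ?R"
    using numerical_range_element[OF _ A(2)] by (intro hull_minimal) (auto simp: f_def)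
  finally have "f A \<in> convex hull ?R" using A(1) by blast
  moreover have "averaged_form G v v \<noteq> 0"
    using averaged_form_self_pos[OF fin _ A(2)] H.one_closed by (auto simp: GL_def)
  then have "f A = z" by (simp add: f_def A averaged_form_scale_left)
  ultimately show "z \<in> convex hull ?R" by simp
qed

end

theorem corollary4p6:
  fixes G :: "(complex ^ 'n ^ 'n) set"
  assumes "subgroup G GL" and "finite G"
  shows "(\<Union>k \<in> eigenvalue_orders G. roots_hull k) \<subseteq> hull_spectrum G
    \<and> hull_spectrum G \<subseteq> convex hull (\<Union>k \<in> eigenvalue_orders G. roots_hull k)"
  using roots_hull_subset_hull_spectrum[OF assms] hull_spectrum_subset[OF assms] by blast

end
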